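(* Let $\mathcal{G}=(\mathcal{V},\mathcal{E})$ (spatial graph) and $G=(V,E)$ (opinion graph) be finite connected graphs, let $\mathbf{d}$ be the diameter of $G$, and let $\tau\in\mathbb{N}$ be the confidence threshold. Let $(\xi_t)$ be the imitation process and $(\zeta_t)$ the attraction process with these parameters, started from arbitrary (possibly random) initial configurations, and let $T$ denote the time to fixation of the process under consideration. Assume $\tau\ge\mathbf{d}$. Then $$P(\xi_T\equiv\mathrm{cst})=P(\zeta_T\equiv\mathrm{cst})=1.$$
   Context: Graphs are simple and undirected; $\mathbb{N}=\{0,1,2,\dots\}$. $d(\cdot,\cdot)$ is the geodesic distance on the opinion graph $G$, and $\mathbf{d}=\max_{a,b\in V}d(a,b)$. Let $\vec{\mathcal{E}}$ be the set of directed edges $\vec{xy},\vec{yx}$ for $\{x,y\}\in\mathcal{E}$. For $a\neq b$ in $V$, let $D(a,b)=\{a'\in V: d(a,a')=1 \text{ and } d(a',b)=d(a,b)-1\}$. Both processes are continuous-time Markov chains on the set of configurations $V^{\mathcal{V}}$ (an opinion in $V$ at each vertex of $\mathcal{V}$), with right-continuous paths. Each directed edge $\vec{xy}\in\vec{\mathcal{E}}$ becomes active at rate one, independently over directed edges and independently of the initial configuration. When $\vec{xy}$ becomes active, the opinion at $x$ is updated if and only if the opinions $a$ at $x$ and $b$ at $y$ satisfy $0<d(a,b)\le\tau$. In the imitation process $(\xi_t)$, the new opinion at $x$ is $b$. In the attraction process $(\zeta_t)$, the new opinion at $x$ is chosen uniformly at random from $D(a,b)$. The time to fixation is $T=\inf\{t\ge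 0:\xi_t=\xi_s\text{ for all }s>t\}$ for the imitation process (with $\inf\varnothing=\infty$), and the same with $\zeta$ in place of $\xi$ for the attraction process. The event $\{\xi_T\equiv\mathrm{cst}\}$ is the event that $T<\infty$ and there is $c\in V$ with $\xi_T(x)=c$ for all $x\in\mathcal{V}$; similarly for $\zeta$. *)

theory Defs
  imports "HOL-Probability.Probability"
begin

text \<open>A finite simple graph is given by its set of edges (two-element sets of vertices);
  its vertex set is the whole of a finite type.\<close>

definition simple_graph :: "'a::finite set set \<Rightarrow> bool" where
  "simple_graph E \<longleftrightarrow> (\<forall>e\<in>E. card e = 2)"

definition directed_edges :: "'a::finite set set \<Rightarrow> ('a \<times> 'a) set" where
  "directed_edges E = {(x, y). {x, y} \<in> E}"

definition graph_connected :: "'a::finite set set \<Rightarrow> bool" where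
  "graph_connected E \<longleftrightarrow> (\<forall>x y. (x, y) \<in> (directed_edges E)\<^sup>*)"

definition geodesic_dist :: "'a::finite set set \<Rightarrow> 'a \<Rightarrow> 'a \<Rightarrow> nat" where
  "geodesic_dist E a b = (LEAST n. (a, b) \<in> directed_edges E ^^ n)"

definition graph_diameter :: "'a::finite set set \<Rightarrow> nat" where
  "graph_diameter E = Max {geodesic_dist E a b | a b. True}"

definition closer_neighbours :: "'a::finite set set \<Rightarrow> 'a \<Rightarrow> 'a \<Rightarrow> 'a set" where
  "closer_neighbours E a b =
     {a'. geodesic_dist E a a' = 1 \<and> geodesic_dist E a' b = geodesic_dist E a b - 1}"

definition right_continuous_path :: "(real \<Rightarrow> 'a) \<Rightarrow> bool" where
  \<comment> \<open>right-continuity on \<open>[0,\<infinity>)\<close> for the discrete topology on \<open>'a\<close>\<close>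
  "right_continuous_path f \<longleftrightarrow> (\<forall>t\<ge>0. \<forall>\<^sub>F u in at_right t. f u = f t)"

text \<open>Poisson counting process of rate \<open>r\<close>. Since paths are monotone, the truncated subtraction
  gives the true increments.\<close>

definition poisson_process :: "'w measure \<Rightarrow> real \<Rightarrow> (real \<Rightarrow> 'w \<Rightarrow> nat) \<Rightarrow> bool" where
  "poisson_process M r N \<longleftrightarrow>
     (\<forall>t\<ge>0. N t \<in> M \<rightarrow>\<^sub>M count_space UNIV) \<and>
     (\<forall>\<omega>\<in>space M. N 0 \<omega> = 0 \<and> mono_on {0..} (\<lambda>t. N t \<omega>) \<and>
        right_continuous_path (\<lambda>t. N t \<omega>)) \<and>
     (\<forall>s t. 0 \<le> s \<and> s < t \<longrightarrow>
        distr M (count_space UNIV) (\<lambda>\<omega>. N t \<omega> - N s \<omega>) =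
          measure_pmf (poisson_pmf (r * (t - s)))) \<and>
     (\<forall>t :: nat \<Rightarrow> real. 0 \<le> t 0 \<and> strict_mono t \<longrightarrow>
        prob_space.indep_vars M (\<lambda>_. count_space UNIV)
          (\<lambda>i \<omega>. N (t (Suc i)) \<omega> - N (t i) \<omega>) UNIV)"

text \<open>The jump times of the counting process.\<close>

definition active_at :: "(real \<Rightarrow> 'w \<Rightarrow> nat) \<Rightarrow> 'w \<Rightarrow> real \<Rightarrow> bool" where
  "active_at N \<omega> t \<longleftrightarrow> 0 < t \<and> (\<forall>u. 0 \<le> u \<and> u < t \<longrightarrow> N u \<omega> < N t \<omega>)"

text \<open>The sigma-algebra generated by a family of discrete random variables.\<close>

definition generated_events :: "'w measure \<Rightarrow> ('w \<Rightarrow> 'b) set \<Rightarrow> 'w set set" where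
  "generated_events M F = sigma_sets (space M) {f -` A \<inter> space M | f A. f \<in> F}"

text \<open>The sources of randomness: the initial configuration, the clock of each directed edge, and
  the choice made at the \<open>k\<close>-th activation of each directed edge.\<close>

datatype 'e source = Initial | Clock 'e | Choice 'e nat

text \<open>\<open>X\<close> evolves by the updates \<open>U e \<omega> t\<close>, applied to the configuration \<open>c\<close> just before time
  \<open>t\<close>, at the activation times \<open>t\<close> of the directed edges \<open>e \<in> D\<close>, and does not change otherwise.
  If two clocks ring simultaneously, the rule asks for both updates at once; for independent Poisson
  clocks this has probability zero, so the predicate is only required for almost every \<open>\<omega>\<close>.\<close>

definition evolves_by ::
  "'e set \<Rightarrow> ('e \<Rightarrow> real \<Rightarrow> 'w \<Rightarrow> nat) \<Rightarrow> ('e \<Rightarrow> 'w \<Rightarrow> real \<Rightarrow> 'c \<Rightarrow> 'c) \<Rightarrow>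
   (real \<Rightarrow> 'w \<Rightarrow> 'c) \<Rightarrow> 'w \<Rightarrow> bool" where
  "evolves_by D N U X \<omega> \<longleftrightarrow>
     (\<forall>t>0. \<exists>c. (\<forall>\<^sub>F u in at_left t. X u \<omega> = c) \<and>
        ((\<forall>e\<in>D. \<not> active_at (N e) \<omega> t) \<longrightarrow> X t \<omega> = c) \<and>
        (\<forall>e\<in>D. active_at (N e) \<omega> t \<longrightarrow> X t \<omega> = U e \<omega> t c))"

definition imitation_update ::
  "'o::finite set set \<Rightarrow> nat \<Rightarrow> 'v \<times> 'v \<Rightarrow> ('v \<Rightarrow> 'o) \<Rightarrow> ('v \<Rightarrow> 'o)" where
  "imitation_update E \<tau> = (\<lambda>(x, y) c.
     if 0 < geodesic_dist E (c x) (c y) \<and> geodesic_dist E (c x) (c y) \<le> \<tau>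
     then c(x := c y) else c)"

definition attraction_update ::
  "'o::finite set set \<Rightarrow> nat \<Rightarrow> ('o \<Rightarrow> 'o \<Rightarrow> 'o) \<Rightarrow> 'v \<times> 'v \<Rightarrow> ('v \<Rightarrow> 'o) \<Rightarrow> ('v \<Rightarrow> 'o)" where
  "attraction_update E \<tau> g = (\<lambda>(x, y) c.
     if 0 < geodesic_dist E (c x) (c y) \<and> geodesic_dist E (c x) (c y) \<le> \<tau>
     then c(x := g (c x) (c y)) else c)"

text \<open>In the following, \<open>S\<close> is the spatial graph, \<open>E\<close> the opinion graph, and \<open>N e\<close> counts the
  activations of the directed edge \<open>e\<close>.\<close>

definition imitation_process ::
  "'v::finite set set \<Rightarrow> 'o::finite set set \<Rightarrow> nat \<Rightarrow> 'w measure \<Rightarrow>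
   ('v \<times> 'v \<Rightarrow> real \<Rightarrow> 'w \<Rightarrow> nat) \<Rightarrow> (real \<Rightarrow> 'w \<Rightarrow> 'v \<Rightarrow> 'o) \<Rightarrow> bool" where
  "imitation_process S E \<tau> M N \<xi> \<longleftrightarrow>
     prob_space M \<and>
     (\<forall>e\<in>directed_edges S. poisson_process M 1 (N e)) \<and>
     (\<forall>t\<ge>0. \<xi> t \<in> M \<rightarrow>\<^sub>M count_space UNIV) \<and>
     (\<forall>\<omega>\<in>space M. right_continuous_path (\<lambda>t. \<xi> t \<omega>)) \<and>
     prob_space.indep_sets M
       (\<lambda>i. case i of
          Initial \<Rightarrow> generated_events M {\<xi> 0}
        | Clock e \<Rightarrow> generated_events M (N e ` {0..})
        | Choice e k \<Rightarrow> {})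
       ({Initial} \<union> Clock ` directed_edges S) \<and>
     (AE \<omega> in M. evolves_by (directed_edges S) N (\<lambda>e \<omega> t. imitation_update E \<tau> e) \<xi> \<omega>)"

text \<open>\<open>C e k \<omega> a b\<close> is the new opinion chosen at the \<open>k\<close>-th activation of \<open>e\<close> if the opinions at
  its endpoints are then \<open>a\<close> and \<open>b\<close>. For given \<open>e\<close> and \<open>k\<close> at most one of the values
  \<open>C e k \<omega> a b\<close> is ever used, so their joint distribution over \<open>(a, b)\<close> is irrelevant.\<close>

definition attraction_process ::
  "'v::finite set set \<Rightarrow> 'o::finite set set \<Rightarrow> nat \<Rightarrow> 'w measure \<Rightarrow>
   ('v \<times> 'v \<Rightarrow> real \<Rightarrow> 'w \<Rightarrow> nat) \<Rightarrow> ('v \<times> 'v \<Rightarrow> nat \<Rightarrow> 'w \<Rightarrow> 'o \<Rightarrow> 'o \<Rightarrow> 'o) \<Rightarrow>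
   (real \<Rightarrow> 'w \<Rightarrow> 'v \<Rightarrow> 'o) \<Rightarrow> bool" where
  "attraction_process S E \<tau> M N C \<zeta> \<longleftrightarrow>
     prob_space M \<and>
     (\<forall>e\<in>directed_edges S. poisson_process M 1 (N e)) \<and>
     (\<forall>e\<in>directed_edges S. \<forall>k. C e k \<in> M \<rightarrow>\<^sub>M count_space UNIV) \<and>
     (\<forall>e\<in>directed_edges S. \<forall>k a b. a \<noteq> b \<longrightarrow>
        distr M (count_space UNIV) (\<lambda>\<omega>. C e k \<omega> a b) =
          measure_pmf (pmf_of_set (closer_neighbours E a b))) \<and>
     (\<forall>t\<ge>0. \<zeta> t \<in> M \<rightarrow>\<^sub>M count_space UNIV) \<and>
     (\<forall>\<omega>\<in>space M. right_continuous_path (\<lambda>t. \<zeta> t \<omega>)) \<and>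
     prob_space.indep_sets M
       (\<lambda>i. case i of
          Initial \<Rightarrow> generated_events M {\<zeta> 0}
        | Clock e \<Rightarrow> generated_events M (N e ` {0..})
        | Choice e k \<Rightarrow> generated_events M {C e k})
       ({Initial} \<union> Clock ` directed_edges S \<union> {Choice e k | e k. e \<in> directed_edges S}) \<and>
     (AE \<omega> in M. evolves_by (directed_edges S) N
        (\<lambda>e \<omega> t. attraction_update E \<tau> (C e (N e t \<omega>) \<omega>) e) \<zeta> \<omega>)"

definition fixation_time :: "(real \<Rightarrow> 'w \<Rightarrow> 'c) \<Rightarrow> 'w \<Rightarrow> ereal" where
  "fixation_time X \<omega> = Inf (ereal ` {t. 0 \<le> t \<and> (\<forall>s>t. X t \<omega> = X s \<omega>)})"

definition consensus_event :: "'w measure \<Rightarrow> (real \<Rightarrow> 'w \<Rightarrow> 'v \<Rightarrow> 'o) \<Rightarrow> 'w set" where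
  "consensus_event M X =
     {\<omega> \<in> space M. fixation_time X \<omega> < \<infinity> \<and>
        (\<exists>c. \<forall>x. X (real_of_ereal (fixation_time X \<omega>)) \<omega> x = c)}"

end

theory Submission
  imports Defs
begin

text \<open>Let vertices join a growing set one by one, each along an edge leading into the set, and
  activate each of these edges as often as the diameter of the opinion graph. As \<open>\<tau>\<close> is at least the
  diameter, every activation brings the opinion at the new vertex strictly closer to the common
  opinion of the set, whatever random choices are made, so this finite list of edges produces
  consensus from every configuration. Cut time into blocks of unit intervals, as many per block as
  the list has entries. The event that in each unit interval of a block only the prescribed edge
  rings has a fixed positive probability, and these events are independent for different blocks, so
  almost surely one of them occurs. Since the list works for all configurations, the Markov property
  is not needed. Consensus is absorbing.\<close>

section \<open>Distances in the opinion graph\<close>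

lemma directed_edges_irrefl: "simple_graph E \<Longrightarrow> (x, x) \<notin> directed_edges E"
  by (auto simp: directed_edges_def simple_graph_def)

lemma geodesic_dist_path:
  assumes "graph_connected E"
  shows "(a, b) \<in> directed_edges E ^^ geodesic_dist E a b"
  unfolding geodesic_dist_def
  by (rule LeastI_ex) (metis assms graph_connected_def rtrancl_imp_relpow)

lemma geodesic_dist_le: "(a, b) \<in> directed_edges E ^^ n \<Longrightarrow> geodesic_dist E a b \<le> n"
  unfolding geodesic_dist_def by (rule Least_le)

lemma geodesic_dist_self [simp]: "geodesic_dist E a a = 0"
  using geodesic_dist_le[of a a 0 E] by simp

lemma geodesic_dist_eq_0_iff:
  assumes "graph_connected E"
  shows "geodesic_dist E a b = 0 \<longleftrightarrow> a = b"
  using geodesic_dist_path[OF assms, of a b] by auto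

lemma geodesic_dist_le_diameter: "geodesic_dist E a b \<le> graph_diameter E"
proof -
  have "{geodesic_dist E a b | a b. True} = range (\<lambda>(a, b). geodesic_dist E a b)" by auto
  then have "finite {geodesic_dist E a b | a b. True}" by simp
  then show ?thesis unfolding graph_diameter_def by (rule Max_ge) auto
qed

text \<open>The first vertex after \<open>a\<close> on a geodesic to \<open>b\<close> qualifies.
  Nonemptiness matters because \<open>pmf_of_set\<close> is specified only for nonempty finite
  sets.\<close>

lemma closer_neighbours_nonempty:
  assumes "simple_graph E" "graph_connected E" "a \<noteq> b"
  shows "closer_neighbours E a b \<noteq> {}"
proof -
  let ?R = "directed_edges E"
  obtain n where n: "geodesic_dist E a b = Suc n"
    using geodesic_dist_eq_0_iff[OF assms(2), of a b] assms(3) not0_implies_Suc by auto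
  then have "(a, b) \<in> ?R ^^ Suc n" using geodesic_dist_path[OF assms(2), of a b] by simp
  then obtain a' where a': "(a, a') \<in> ?R" "(a', b) \<in> ?R ^^ n"
    by (blast elim: relpow_Suc_E2)
  have "a \<noteq> a'" using a'(1) directed_edges_irrefl[OF assms(1)] by auto
  moreover have "geodesic_dist E a a' \<le> 1"
    using geodesic_dist_le[of a a' 1 E] a'(1) by simp
  ultimately have 1: "geodesic_dist E a a' = 1"
    using geodesic_dist_eq_0_iff[OF assms(2), of a a'] by linarith
  \<comment> \<open>Prepending the edge to a geodesic from \<open>a'\<close> bounds the distance
    from \<open>a'\<close> below; the remaining path of length \<open>n\<close> bounds it
    above.\<close>
  have "(a, b) \<in> ?R ^^ Suc (geodesic_dist E a' b)"
    using a'(1) geodesic_dist_path[OF assms(2), of a' b] by (rule relpow_Suc_I2)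
  then have "geodesic_dist E a b \<le> Suc (geodesic_dist E a' b)" by (rule geodesic_dist_le)
  then have "geodesic_dist E a' b = n" using n geodesic_dist_le[OF a'(2)] by simp
  with 1 n show ?thesis unfolding closer_neighbours_def by auto
qed


section \<open>A universal sequence of updates\<close>

text \<open>Both dynamics are treated through this common relation: an update along an edge brings the
  opinion at its first vertex at least one step closer to that at the second, unless they agree.\<close>

definition moves_towards ::
  "'o::finite set set \<Rightarrow> 'v \<times> 'v \<Rightarrow> ('v \<Rightarrow> 'o) \<Rightarrow> ('v \<Rightarrow> 'o) \<Rightarrow> bool" where
  "moves_towards E e c c' \<longleftrightarrow> (\<forall>w. w \<noteq> fst e \<longrightarrow> c' w = c w) \<and>
     geodesic_dist E (c' (fst e)) (c (snd e)) \<le> geodesic_dist E (c (fst e)) (c (snd e)) - 1"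

text \<open>A relation instead of a function, so that every outcome of the random choices is covered
  at once.\<close>

fun steps :: "('e \<Rightarrow> 'c \<Rightarrow> 'c \<Rightarrow> bool) \<Rightarrow> 'e list \<Rightarrow> 'c \<Rightarrow> 'c \<Rightarrow> bool" where
  "steps R [] c c' \<longleftrightarrow> c = c'"
| "steps R (e # es) c c' \<longleftrightarrow> (\<exists>d. R e c d \<and> steps R es d c')"

lemma steps_append: "steps R (es @ fs) c c' \<longleftrightarrow> (\<exists>d. steps R es c d \<and> steps R fs d c')"
  by (induction es arbitrary: c) auto

text \<open>Since \<open>\<tau>\<close> is at least the diameter, the confidence test fails only
  when the opinions agree; otherwise a single update makes the distance 0.\<close>

lemma moves_towards_imitation:
  assumes "graph_connected E" "graph_diameter E \<le> \<tau>"
  shows "moves_towards E e c (imitation_update E \<tau> e c)"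
proof -
  have "geodesic_dist E a b \<le> \<tau>" for a b
    using geodesic_dist_le_diameter[of E a b] assms(2) by simp
  then show ?thesis
    using geodesic_dist_eq_0_iff[OF assms(1)]
    by (cases e) (auto simp: moves_towards_def imitation_update_def)
qed

text \<open>An update takes place only at positive distance, so \<open>g\<close> is constrained off
  the diagonal; any value in \<open>closer_neighbours\<close> then lowers the distance by exactly
  one.\<close>

lemma moves_towards_attraction:
  assumes "graph_connected E" "graph_diameter E \<le> \<tau>"
    and g: "\<And>a b. a \<noteq> b \<Longrightarrow> g a b \<in> closer_neighbours E a b"
  shows "moves_towards E e c (attraction_update E \<tau> g e c)"
proof -
  have "geodesic_dist E a b \<le> \<tau>" for a b
    using geodesic_dist_le_diameter[of E a b] assms(2) by simp
  moreover have "geodesic_dist E (g a b) b = geodesic_dist E a b - 1"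
    if "0 < geodesic_dist E a b" for a b
  proof -
    have "a \<noteq> b" using that by auto
    then show ?thesis using g[of a b] by (simp add: closer_neighbours_def)
  qed
  ultimately show ?thesis
    using geodesic_dist_eq_0_iff[OF assms(1)]
    by (cases e) (auto simp: moves_towards_def attraction_update_def)
qed

text \<open>Truncated subtraction keeps distance 0 at 0, so the updated vertex cannot leave the
  consensus.\<close>

lemma moves_towards_const:
  assumes "graph_connected E" "moves_towards E e (\<lambda>_. a) c"
  shows "c = (\<lambda>_. a)"
proof
  fix w
  have "geodesic_dist E (c (fst e)) a = 0"
    using assms(2) by (simp add: moves_towards_def)
  then have "c (fst e) = a" using geodesic_dist_eq_0_iff[OF assms(1)] by blast
  then show "c w = a" using assms(2) by (cases "w = fst e") (auto simp: moves_towards_def)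
qed

text \<open>As \<open>x \<noteq> y\<close>, the target opinion \<open>c y\<close> stays put while
  \<open>x\<close> moves, so the decrements add up.\<close>

lemma steps_replicate_moves_towards:
  assumes "x \<noteq> y" "steps (moves_towards E) (replicate m (x, y)) c c'"
  shows "(\<forall>w. w \<noteq> x \<longrightarrow> c' w = c w) \<and>
    geodesic_dist E (c' x) (c y) \<le> geodesic_dist E (c x) (c y) - m"
  using assms(2)
proof (induction m arbitrary: c)
  case (Suc m)
  then obtain d where d: "moves_towards E (x, y) c d"
    and "steps (moves_towards E) (replicate m (x, y)) d c'" by auto
  with Suc.IH have IH: "\<forall>w. w \<noteq> x \<longrightarrow> c' w = d w"
    "geodesic_dist E (c' x) (d y) \<le> geodesic_dist E (d x) (d y) - m" by auto
  have d': "\<forall>w. w \<noteq> x \<longrightarrow> d w = c w"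
    "geodesic_dist E (d x) (c y) \<le> geodesic_dist E (c x) (c y) - 1"
    using d by (auto simp: moves_towards_def)
  then have "d y = c y" using assms(1) by simp
  with IH(2) d'(2) have "geodesic_dist E (c' x) (c y) \<le> geodesic_dist E (c x) (c y) - Suc m"
    by simp
  with IH(1) d'(1) show ?case by simp
qed auto

text \<open>A path from \<open>x\<close> to \<open>y\<close> has to enter \<open>A\<close> along
  some edge.\<close>

lemma connected_boundary_edge:
  assumes "graph_connected S" "y \<in> A" "x \<notin> A"
  obtains u v where "u \<notin> A" "v \<in> A" "(u, v) \<in> directed_edges S"
proof -
  have "(x, y) \<in> (directed_edges S)\<^sup>*" using assms(1) by (simp add: graph_connected_def)
  then have "\<exists>u v. u \<notin> A \<and> v \<in> A \<and> (u, v) \<in> directed_edges S"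
    using assms(2,3) by (induction rule: converse_rtrancl_induct) blast+
  then show ?thesis using that by blast
qed

text \<open>The agreeing set grows one vertex at a time: repeating an edge that leads into it as often
  as the diameter of the opinion graph makes the outer vertex join, whatever choices are made.\<close>

lemma ex_universal_edge_list:
  fixes S :: "'v::finite set set" and E :: "'o::finite set set"
  assumes "graph_connected S" "graph_connected E"
  obtains es where "set es \<subseteq> directed_edges S"
    "\<And>c c'. steps (moves_towards E) es c c' \<Longrightarrow> \<exists>a. c' = (\<lambda>_. a)"
proof -
  let ?agree = "\<lambda>A es. set es \<subseteq> directed_edges S \<and>
    (\<forall>c c'. steps (moves_towards E) es c c' \<longrightarrow> (\<exists>a. \<forall>x\<in>A. c' x = a))"
  \<comment> \<open>Induction on the size of the agreeing set, shifted by one because it starts as a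
    singleton with the empty list.\<close>
  have "\<exists>A es. card A = Suc n \<and> ?agree A es" if "n < CARD('v)" for n
    using that
  proof (induction n)
    case 0
    have "card {undefined :: 'v} = Suc 0 \<and> ?agree {undefined :: 'v} []" by simp
    then show ?case by blast
  next
    case (Suc n)
    then obtain A :: "'v set" and es where A: "card A = Suc n" and es: "?agree A es" by auto
    obtain y where y: "y \<in> A" using A by fastforce
    have "A \<noteq> UNIV" using A Suc.prems by auto
    then obtain x where "x \<notin> A" by blast
    then obtain u v where uv: "u \<notin> A" "v \<in> A" "(u, v) \<in> directed_edges S"
      using connected_boundary_edge[OF assms(1) y] by blast
    let ?m = "graph_diameter E" and ?A = "insert u A"
    let ?es = "es @ replicate ?m (u, v)"
    have "u \<noteq> v" using uv by auto
    have "\<exists>a. \<forall>x\<in>?A. c' x = a" if st: "steps (moves_towards E) ?es c c'" for c c'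
    proof -
      obtain d where "steps (moves_towards E) es c d"
        and d: "steps (moves_towards E) (replicate ?m (u, v)) d c'"
        using st by (auto simp: steps_append)
      then obtain a where a: "\<forall>x\<in>A. d x = a" using es by blast
      note * = steps_replicate_moves_towards[OF \<open>u \<noteq> v\<close> d]
      \<comment> \<open>The distance at the start is at most the diameter \<open>?m\<close>, so
        \<open>?m\<close> decrements exhaust it.\<close>
      then have "geodesic_dist E (c' u) (d v) = 0"
        using geodesic_dist_le_diameter[of E "d u" "d v"] by simp
      then have "c' u = d v" using geodesic_dist_eq_0_iff[OF assms(2)] by blast
      with * a uv have "\<forall>x\<in>?A. c' x = a" by (metis insert_iff)
      then show ?thesis by blast
    qed
    moreover have "set ?es \<subseteq> directed_edges S" using es uv(3) by auto
    moreover have "card ?A = Suc (Suc n)" using A uv(1) by simp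
    ultimately show ?case by blast
  qed
  from this[of "CARD('v) - 1"] obtain A :: "'v set" and es
    where "card A = CARD('v)" and es: "?agree A es" by auto
  then have "A = UNIV" by (metis card_subset_eq finite top_greatest)
  with es show ?thesis by (intro that[of es]) (auto simp: fun_eq_iff)
qed


section \<open>Paths driven by clocks\<close>

text \<open>This is \<open>evolves_by\<close> with the update functions weakened to a relation, a
  form shared by both processes that forgets which choices were made.\<close>

definition follows_clocks ::
  "'e set \<Rightarrow> ('e \<Rightarrow> real \<Rightarrow> 'w \<Rightarrow> nat) \<Rightarrow> ('e \<Rightarrow> 'c \<Rightarrow> 'c \<Rightarrow> bool) \<Rightarrow>
   (real \<Rightarrow> 'w \<Rightarrow> 'c) \<Rightarrow> 'w \<Rightarrow> bool" where
  "follows_clocks D N R X \<omega> \<longleftrightarrow>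
     (\<forall>t>0. \<exists>c. (\<forall>\<^sub>F u in at_left t. X u \<omega> = c) \<and>
        ((\<forall>e\<in>D. \<not> active_at (N e) \<omega> t) \<longrightarrow> X t \<omega> = c) \<and>
        (\<forall>e\<in>D. active_at (N e) \<omega> t \<longrightarrow> R e c (X t \<omega>)))"

lemma evolves_by_imp_follows_clocks:
  assumes "evolves_by D N U X \<omega>" "\<And>e t c. e \<in> D \<Longrightarrow> 0 < t \<Longrightarrow> R e c (U e \<omega> t c)"
  shows "follows_clocks D N R X \<omega>"
  using assms unfolding evolves_by_def follows_clocks_def by metis

lemma eventually_at_right_witness:
  fixes t b :: real
  assumes "\<forall>\<^sub>F u in at_right t. P u" "t < b"
  obtains r where "t < r" "r \<le> b" "\<And>u. t < u \<Longrightarrow> u < r \<Longrightarrow> P u"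
proof -
  obtain r where "t < r" "\<And>u. t < u \<Longrightarrow> u < r \<Longrightarrow> P u"
    using assms(1) unfolding eventually_at_right_field by auto
  with assms(2) show ?thesis by (intro that[of "min r b"]) auto
qed

text \<open>Real induction: look at the infimum of the times at which the property fails.\<close>

lemma path_invariant:
  fixes f :: "real \<Rightarrow> 'c"
  assumes rc: "right_continuous_path f" and s: "0 \<le> s" "s \<le> t" and Ps: "P (f s)"
    and jump: "\<And>u c. s < u \<Longrightarrow> u \<le> t \<Longrightarrow> \<forall>\<^sub>F v in at_left u. f v = c \<Longrightarrow> P c \<Longrightarrow> P (f u)"
    and left: "\<And>u. s < u \<Longrightarrow> u \<le> t \<Longrightarrow> \<exists>c. \<forall>\<^sub>F v in at_left u. f v = c"
  shows "P (f t)"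
proof (rule ccontr)
  assume nP: "\<not> P (f t)"
  define B where "B = {v \<in> {s..t}. \<not> P (f v)}"
  define b where "b = Inf B"
  have "t \<in> B" using nP s by (simp add: B_def)
  have bdd: "bdd_below B" by (rule bdd_belowI[of _ s]) (simp add: B_def)
  have bt: "b \<le> t" unfolding b_def by (rule cInf_lower[OF \<open>t \<in> B\<close> bdd])
  have sb: "s \<le> b" unfolding b_def using \<open>t \<in> B\<close> by (intro cInf_greatest) (auto simp: B_def)
  have below: "P (f v)" if "s \<le> v" "v < b" for v
  proof (rule ccontr)
    assume "\<not> P (f v)"
    then have "v \<in> B" using that bt by (simp add: B_def)
    then have "b \<le> v" unfolding b_def by (intro cInf_lower bdd)
    with that show False by simp
  qed
  \<comment> \<open>If \<open>s < b\<close>, the left limit at \<open>b\<close> is a value taken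
    just before \<open>b\<close>, where \<open>P\<close> holds, and \<open>jump\<close> carries
    \<open>P\<close> over to \<open>f b\<close>.\<close>
  have Pb: "P (f b)"
  proof (cases "b = s")
    case False
    with sb have "s < b" by simp
    obtain c where c: "\<forall>\<^sub>F v in at_left b. f v = c" using left[OF \<open>s < b\<close> bt] by blast
    have "\<forall>\<^sub>F v in at_left b. v \<in> {s<..<b}"
      using \<open>s < b\<close> by (rule eventually_at_left_real)
    with c have "\<forall>\<^sub>F v in at_left b. P c"
      by eventually_elim (use below in force)
    then have "P c" by simp
    with jump[OF \<open>s < b\<close> bt c] show ?thesis by blast
  qed (use Ps in simp)
  with nP bt have "b < t" by (metis order_le_less)
  \<comment> \<open>Right-continuity keeps \<open>P\<close> true for a while after \<open>b\<close>,
    so \<open>b\<close> cannot be the infimum of the failures.\<close>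
  have "\<forall>\<^sub>F u in at_right b. f u = f b"
    using rc sb s(1) by (auto simp: right_continuous_path_def)
  then obtain r where r: "b < r" "r \<le> t" "\<And>u. b < u \<Longrightarrow> u < r \<Longrightarrow> f u = f b"
    using \<open>b < t\<close> by (rule eventually_at_right_witness) blast
  have "r \<le> b" unfolding b_def
  proof (rule cInf_greatest)
    fix v assume v: "v \<in> B"
    then have "b \<le> v" unfolding b_def by (intro cInf_lower bdd)
    show "r \<le> v"
    proof (rule ccontr)
      assume "\<not> r \<le> v"
      then have "f v = f b" using r(3)[of v] \<open>b \<le> v\<close> by (cases "v = b") auto
      with Pb v show False by (simp add: B_def)
    qed
  qed (use \<open>t \<in> B\<close> in auto)
  with r(1) show False by simp
qed

text \<open>The required time is the first one at which the count exceeds its value at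
  \<open>s\<close>. Right-continuity makes this infimum attained, and monotonicity covers the times
  before \<open>s\<close> in \<open>active_at\<close>.\<close>

lemma ex_active_time:
  assumes rc: "right_continuous_path (\<lambda>t. N t \<omega>)" and mono: "mono_on {0..} (\<lambda>t. N t \<omega>)"
    and s: "0 \<le> s" "s \<le> t" and less: "N s \<omega> < N t \<omega>"
  obtains u where "s < u" "u \<le> t" "active_at N \<omega> u"
proof -
  define B where "B = {v \<in> {s..t}. N s \<omega> < N v \<omega>}"
  define b where "b = Inf B"
  have "t \<in> B" using less s by (simp add: B_def)
  have bdd: "bdd_below B" by (rule bdd_belowI[of _ s]) (simp add: B_def)
  have bt: "b \<le> t" unfolding b_def by (rule cInf_lower[OF \<open>t \<in> B\<close> bdd])
  have sb: "s \<le> b" unfolding b_def using \<open>t \<in> B\<close> by (intro cInf_greatest) (auto simp: B_def)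
  have below: "N v \<omega> \<le> N s \<omega>" if "0 \<le> v" "v < b" for v
  proof (cases "s \<le> v")
    case True
    have "v \<notin> B" using that(2) cInf_lower[OF _ bdd, of v] unfolding b_def by force
    with True that bt show ?thesis by (simp add: B_def not_less)
  next
    case False
    then show ?thesis using mono_onD[OF mono, of v s] that s by simp
  qed
  have Nb: "N s \<omega> < N b \<omega>"
  proof (rule ccontr)
    assume nb: "\<not> N s \<omega> < N b \<omega>"
    with less bt have "b < t" by (metis order_le_less)
    have "\<forall>\<^sub>F u in at_right b. N u \<omega> = N b \<omega>"
      using rc sb s(1) by (auto simp: right_continuous_path_def)
    then obtain r where r: "b < r" "r \<le> t" "\<And>u. b < u \<Longrightarrow> u < r \<Longrightarrow> N u \<omega> = N b \<omega>"
      using \<open>b < t\<close> by (rule eventually_at_right_witness) blast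
    have "r \<le> b" unfolding b_def
    proof (rule cInf_greatest)
      fix v assume v: "v \<in> B"
      then have "b \<le> v" unfolding b_def by (intro cInf_lower bdd)
      show "r \<le> v"
      proof (rule ccontr)
        assume "\<not> r \<le> v"
        then have "N v \<omega> = N b \<omega>" using r(3)[of v] \<open>b \<le> v\<close> by (cases "v = b") auto
        with nb v show False by (simp add: B_def)
      qed
    qed (use \<open>t \<in> B\<close> in auto)
    with r(1) show False by simp
  qed
  then have "s < b" using sb by (metis less_irrefl order_le_less)
  moreover have "active_at N \<omega> b"
    using below Nb \<open>s < b\<close> s unfolding active_at_def by (meson le_less_trans)
  ultimately show ?thesis using bt that by blast
qed

lemma not_active_if_constant:
  assumes "mono_on {0..} (\<lambda>t. N t \<omega>)" "0 \<le> s" "N t \<omega> = N s \<omega>" "s < u" "u \<le> t"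
  shows "\<not> active_at N \<omega> u"
proof
  assume "active_at N \<omega> u"
  then have "N s \<omega> < N u \<omega>" using assms by (simp add: active_at_def)
  also have "N u \<omega> \<le> N t \<omega>" using mono_onD[OF assms(1), of u t] assms by simp
  finally show False using assms by simp
qed

text \<open>Only \<open>e\<close> can ring in \<open>(s, t]\<close>, and one ring suffices: further
  rings never increase the distance, so their number is left open.\<close>

lemma moves_towards_if_only_active:
  fixes X :: "real \<Rightarrow> 'w \<Rightarrow> 'v \<Rightarrow> 'o::finite"
  assumes rcX: "right_continuous_path (\<lambda>t. X t \<omega>)"
    and rcN: "\<And>e. e \<in> D \<Longrightarrow> right_continuous_path (\<lambda>t. N e t \<omega>)"
    and mono: "\<And>e. e \<in> D \<Longrightarrow> mono_on {0..} (\<lambda>t. N e t \<omega>)"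
    and fol: "follows_clocks D N (moves_towards E) X \<omega>"
    and e: "e \<in> D" "fst e \<noteq> snd e" and s: "0 \<le> s" "s \<le> t"
    and ring: "N e s \<omega> < N e t \<omega>"
    and quiet: "\<And>e'. e' \<in> D \<Longrightarrow> e' \<noteq> e \<Longrightarrow> N e' t \<omega> = N e' s \<omega>"
  shows "moves_towards E e (X s \<omega>) (X t \<omega>)"
proof -
  obtain x y where xy: "e = (x, y)" by (cases e)
  then have "x \<noteq> y" using e(2) by simp
  let ?c = "X s \<omega>"
  let ?n = "geodesic_dist E (?c x) (?c y)"
  \<comment> \<open>The invariant compares with the fixed configuration at time \<open>s\<close>;
    this is legitimate because the opinion at \<open>y\<close> does not change.\<close>
  define P where "P m c \<longleftrightarrow> (\<forall>w. w \<noteq> x \<longrightarrow> c w = ?c w) \<and> geodesic_dist E (c x) (?c y) \<le> m" for m c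
  have P_move: "P (m - 1) c'" if "P m c" "moves_towards E e c c'" for m c c'
  proof -
    have c: "\<forall>w. w \<noteq> x \<longrightarrow> c w = ?c w" "geodesic_dist E (c x) (?c y) \<le> m"
      using that(1) by (auto simp: P_def)
    have "\<forall>w. w \<noteq> x \<longrightarrow> c' w = c w"
      "geodesic_dist E (c' x) (c y) \<le> geodesic_dist E (c x) (c y) - 1"
      using that(2) by (auto simp: moves_towards_def xy)
    moreover have "c y = ?c y" using c(1) \<open>x \<noteq> y\<close> by simp
    ultimately show ?thesis using c by (simp add: P_def)
  qed
  have at: "\<exists>c. (\<forall>\<^sub>F v in at_left u. X v \<omega> = c) \<and> (X u \<omega> = c \<or> moves_towards E e c (X u \<omega>)) \<and>
      (active_at (N e) \<omega> u \<longrightarrow> moves_towards E e c (X u \<omega>))" if u: "s < u" "u \<le> t" for u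
  proof -
    have "0 < u" using u s by simp
    then obtain c where c: "\<forall>\<^sub>F v in at_left u. X v \<omega> = c"
      "(\<forall>e\<in>D. \<not> active_at (N e) \<omega> u) \<longrightarrow> X u \<omega> = c"
      "\<forall>e\<in>D. active_at (N e) \<omega> u \<longrightarrow> moves_towards E e c (X u \<omega>)"
      using fol unfolding follows_clocks_def by blast
    have "\<not> active_at (N e') \<omega> u" if "e' \<in> D" "e' \<noteq> e" for e'
      by (rule not_active_if_constant[where N = "N e'", OF mono[OF that(1)] s(1) quiet[OF that] u])
    with c e(1) show ?thesis by blast
  qed
  have left: "\<exists>c. \<forall>\<^sub>F v in at_left u. X v \<omega> = c" if "s < u" "u \<le> t" for u
    using at[OF that] by blast
  have jump: "P m (X u \<omega>)"
    if u: "s < u" "u \<le> t" and c: "\<forall>\<^sub>F v in at_left u. X v \<omega> = c" "P m c" for m u c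
  proof -
    obtain d where d: "\<forall>\<^sub>F v in at_left u. X v \<omega> = d" "X u \<omega> = d \<or> moves_towards E e d (X u \<omega>)"
      using at[OF u] by blast
    \<comment> \<open>Left limits are unique because \<open>at_left u\<close> is not the trivial
      filter.\<close>
    from c(1) d(1) have "\<forall>\<^sub>F v in at_left u. c = d" by eventually_elim simp
    then have "c = d" by simp
    moreover have "P m c'" if "P (m - 1) c'" for c' using that by (auto simp: P_def)
    ultimately show ?thesis using d(2) P_move[OF c(2)] c(2) by blast
  qed
  have inv: "P m (X v \<omega>)" if "s \<le> r" "r \<le> v" "v \<le> t" "P m (X r \<omega>)" for m r v
  proof (rule path_invariant[where P = "P m", OF rcX _ that(2,4)])
    show "0 \<le> r" using that s by simp
    show "P m (X u \<omega>)"
      if "r < u" "u \<le> v" "\<forall>\<^sub>F v in at_left u. X v \<omega> = c" "P m c" for u c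
      using that \<open>s \<le> r\<close> \<open>v \<le> t\<close> by (intro jump[of u c]) linarith+
    show "\<exists>c. \<forall>\<^sub>F v in at_left u. X v \<omega> = c" if "r < u" "u \<le> v" for u
      using that \<open>s \<le> r\<close> \<open>v \<le> t\<close> by (intro left) linarith+
  qed
  have Ps: "P ?n (X s \<omega>)" by (simp add: P_def)
  \<comment> \<open>Three stages: \<open>P ?n\<close> persists from \<open>s\<close> up to the left
    limit at a ring \<open>u\<close>, the ring lowers the bound to \<open>?n - 1\<close>, and the
    new bound persists until \<open>t\<close>.\<close>
  obtain u where u: "s < u" "u \<le> t" "active_at (N e) \<omega> u"
    using ex_active_time[where N = "N e", OF rcN[OF e(1)] mono[OF e(1)] s ring] by blast
  obtain c where c: "\<forall>\<^sub>F v in at_left u. X v \<omega> = c" "moves_towards E e c (X u \<omega>)"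
    using at[OF u(1,2)] u(3) by blast
  have "\<forall>\<^sub>F v in at_left u. v \<in> {s<..<u}"
    using u(1) by (rule eventually_at_left_real)
  with c(1) have "\<forall>\<^sub>F v in at_left u. P ?n c"
  proof eventually_elim
    fix v assume v: "X v \<omega> = c" "v \<in> {s<..<u}"
    then have "P ?n (X v \<omega>)"
      by (intro inv[OF order_refl _ _ Ps]) (use u in auto)
    with v(1) show "P ?n c" by simp
  qed
  then have "P ?n c" by simp
  then have "P (?n - 1) (X u \<omega>)" using c(2) by (rule P_move)
  then have "P (?n - 1) (X t \<omega>)"
    by (intro inv[of u t]) (use u in auto)
  then show ?thesis by (simp add: P_def moves_towards_def xy)
qed

text \<open>Chains \<open>moves_towards_if_only_active\<close> over consecutive unit intervals, the
  one starting at \<open>k + i\<close> being reserved for \<open>es ! i\<close>.\<close>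

lemma steps_along_block:
  fixes X :: "real \<Rightarrow> 'w \<Rightarrow> 'v \<Rightarrow> 'o::finite"
  assumes rcX: "right_continuous_path (\<lambda>t. X t \<omega>)"
    and rcN: "\<And>e. e \<in> D \<Longrightarrow> right_continuous_path (\<lambda>t. N e t \<omega>)"
    and mono: "\<And>e. e \<in> D \<Longrightarrow> mono_on {0..} (\<lambda>t. N e t \<omega>)"
    and fol: "follows_clocks D N (moves_towards E) X \<omega>"
    and irr: "\<And>e. e \<in> D \<Longrightarrow> fst e \<noteq> snd e"
    and es: "set es \<subseteq> D"
    and ring: "\<And>i. i < length es \<Longrightarrow>
      N (es ! i) (real (k + i)) \<omega> < N (es ! i) (real (Suc (k + i))) \<omega>"
    and quiet: "\<And>i e. i < length es \<Longrightarrow> e \<in> D \<Longrightarrow> e \<noteq> es ! i \<Longrightarrow>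
      N e (real (Suc (k + i))) \<omega> = N e (real (k + i)) \<omega>"
  shows "steps (moves_towards E) es (X (real k) \<omega>) (X (real (k + length es)) \<omega>)"
  using es ring quiet
proof (induction es arbitrary: k)
  case (Cons e es)
  have "e \<in> D" using Cons.prems(1) by simp
  then have "moves_towards E e (X (real k) \<omega>) (X (real (Suc k)) \<omega>)"
    using Cons.prems(2)[of 0] Cons.prems(3)[of 0] irr[of e]
    by (intro moves_towards_if_only_active[where D = D and N = N, OF rcX rcN mono fol]) auto
  moreover have "steps (moves_towards E) es (X (real (Suc k)) \<omega>) (X (real (Suc k + length es)) \<omega>)"
    using Cons.prems(1) Cons.prems(2)[of "Suc _"] Cons.prems(3)[of "Suc _"]
    by (intro Cons.IH) auto
  ultimately show ?case by auto
qed simp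

text \<open>Every ring, of whichever edge, fixes a constant configuration, so constancy passes
  through each jump.\<close>

lemma consensus_persists:
  fixes X :: "real \<Rightarrow> 'w \<Rightarrow> 'v \<Rightarrow> 'o::finite"
  assumes rcX: "right_continuous_path (\<lambda>t. X t \<omega>)" and conn: "graph_connected E"
    and fol: "follows_clocks D N (moves_towards E) X \<omega>"
    and s: "0 \<le> s" "s \<le> t" and const: "X s \<omega> = (\<lambda>_. a)"
  shows "X t \<omega> = (\<lambda>_. a)"
proof (rule path_invariant[OF rcX s, of "\<lambda>c. c = (\<lambda>_. a)"])
  fix u c
  assume u: "s < u" "u \<le> t" and c: "\<forall>\<^sub>F v in at_left u. X v \<omega> = c" "c = (\<lambda>_. a)"
  have "0 < u" using u s by simp
  then obtain d where d: "\<forall>\<^sub>F v in at_left u. X v \<omega> = d"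
    "(\<forall>e\<in>D. \<not> active_at (N e) \<omega> u) \<longrightarrow> X u \<omega> = d"
    "\<forall>e\<in>D. active_at (N e) \<omega> u \<longrightarrow> moves_towards E e d (X u \<omega>)"
    using fol unfolding follows_clocks_def by blast
  from c(1) d(1) have "\<forall>\<^sub>F v in at_left u. c = d" by eventually_elim simp
  then have "d = (\<lambda>_. a)" using c(2) by simp
  with d(2,3) show "X u \<omega> = (\<lambda>_. a)" using moves_towards_const[OF conn] by blast
next
  fix u assume "s < u"
  then have "0 < u" using s by simp
  then show "\<exists>c. \<forall>\<^sub>F v in at_left u. X v \<omega> = c"
    using fol unfolding follows_clocks_def by blast
qed (rule const)


section \<open>The consensus event\<close>

text \<open>Right-continuity makes the infimum defining the fixation time attained, so the
  configuration at that time is the final one. The integer \<open>n\<close> makes the right-hand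
  side a countable union over starting times.\<close>

lemma consensus_event_iff:
  assumes rc: "right_continuous_path (\<lambda>t. X t \<omega>)" and "\<omega> \<in> space M"
  shows "\<omega> \<in> consensus_event M X \<longleftrightarrow> (\<exists>a. \<exists>n::nat. \<forall>t\<ge>real n. X t \<omega> = (\<lambda>_. a))"
proof -
  define F where "F = {t. 0 \<le> t \<and> (\<forall>s>t. X t \<omega> = X s \<omega>)}"
  have fix_eq: "fixation_time X \<omega> = Inf (ereal ` F)" by (simp add: fixation_time_def F_def)
  have bdd: "bdd_below F" by (rule bdd_belowI[of _ 0]) (simp add: F_def)
  have F_D: "X s \<omega> = X b \<omega>" if "b \<in> F" "b \<le> s" for b s
    using that unfolding F_def by (metis (mono_tags, lifting) mem_Collect_eq order_le_less)
  have F_I: "b \<in> F" if "0 \<le> b" "\<And>s. b < s \<Longrightarrow> X b \<omega> = X s \<omega>" for b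
    using that unfolding F_def by blast
  have finite_time: "fixation_time X \<omega> = ereal (Inf F)" "Inf F \<in> F" if ne: "F \<noteq> {}"
  proof -
    show "fixation_time X \<omega> = ereal (Inf F)"
      unfolding fix_eq using ereal_Inf'[OF bdd ne] by simp
    have "0 \<le> Inf F" using ne by (intro cInf_greatest) (auto simp: F_def)
    \<comment> \<open>Some element of \<open>F\<close> precedes both times, so the path is constant
      on the open ray after \<open>Inf F\<close>; right-continuity then adds the endpoint.\<close>
    have late: "X s \<omega> = X r \<omega>" if sr: "Inf F < s" "Inf F < r" for s r
    proof -
      obtain f where f: "f \<in> F" "f < min s r"
        using cInf_lessD[OF ne, of "min s r"] sr by auto
      then show ?thesis using F_D[of f s] F_D[of f r] by simp
    qed
    have "\<forall>\<^sub>F u in at_right (Inf F). X u \<omega> = X (Inf F) \<omega>"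
      using rc \<open>0 \<le> Inf F\<close> by (simp add: right_continuous_path_def)
    then obtain r where r: "Inf F < r" "\<And>u. Inf F < u \<Longrightarrow> u < r \<Longrightarrow> X u \<omega> = X (Inf F) \<omega>"
      unfolding eventually_at_right_field by auto
    obtain u where "Inf F < u" "u < r" using dense[OF r(1)] by auto
    then have "X (Inf F) \<omega> = X s \<omega>" if "Inf F < s" for s
      using r(2)[of u] late[OF _ that, of u] by simp
    with \<open>0 \<le> Inf F\<close> show "Inf F \<in> F" by (rule F_I)
  qed
  show ?thesis
  proof
    assume cons: "\<omega> \<in> consensus_event M X"
    have ne: "F \<noteq> {}"
    proof
      assume "F = {}"
      \<comment> \<open>The infimum of the empty set in \<open>ereal\<close> is the top
        element.\<close>
      then have "fixation_time X \<omega> = \<infinity>" by (simp add: fix_eq top_ereal_def)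
      with cons show False by (simp add: consensus_event_def)
    qed
    with cons finite_time(1)[OF ne] obtain a where a: "\<forall>x. X (Inf F) \<omega> x = a"
      by (auto simp: consensus_event_def)
    obtain n :: nat where n: "Inf F < real n" using reals_Archimedean2 by blast
    have "X t \<omega> = (\<lambda>_. a)" if "real n \<le> t" for t
      using F_D[OF finite_time(2)[OF ne], of t] n that a by (simp add: fun_eq_iff)
    then show "\<exists>a. \<exists>n::nat. \<forall>t\<ge>real n. X t \<omega> = (\<lambda>_. a)" by blast
  next
    assume "\<exists>a. \<exists>n::nat. \<forall>t\<ge>real n. X t \<omega> = (\<lambda>_. a)"
    then obtain a and n :: nat where n: "\<And>t. real n \<le> t \<Longrightarrow> X t \<omega> = (\<lambda>_. a)" by blast
    then have "real n \<in> F" by (intro F_I) auto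
    then have ne: "F \<noteq> {}" by blast
    have "Inf F \<le> real n" using \<open>real n \<in> F\<close> bdd by (rule cInf_lower)
    then have "X (real n) \<omega> = X (Inf F) \<omega>" by (rule F_D[OF finite_time(2)[OF ne]])
    with n[of "real n"] finite_time(1)[OF ne] assms(2) show "\<omega> \<in> consensus_event M X"
      by (auto simp: consensus_event_def)
  qed
qed

text \<open>There are rational times immediately to the right of \<open>t\<close>, where the path
  still has the value \<open>f t\<close>.\<close>

lemma right_continuous_path_eqI:
  assumes rc: "right_continuous_path f" and q: "\<And>q. q \<in> \<rat> \<Longrightarrow> s \<le> q \<Longrightarrow> f q = c"
    and "0 \<le> s" "s \<le> t"
  shows "f t = c"
proof -
  have "\<forall>\<^sub>F u in at_right t. f u = f t" using rc assms by (simp add: right_continuous_path_def)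
  then obtain r where r: "t < r" "\<And>u. t < u \<Longrightarrow> u < r \<Longrightarrow> f u = f t"
    unfolding eventually_at_right_field by auto
  obtain q where "q \<in> \<rat>" "t < q" "q < r" using Rats_dense_in_real[OF r(1)] by blast
  then have "f q = f t" "f q = c" using r(2) q assms(4) by (blast, force)
  then show ?thesis by simp
qed

text \<open>By right-continuity the quantifier over real times may be restricted to rational ones,
  which leaves only finite and countable operations on events.\<close>

lemma sets_consensus_event:
  fixes X :: "real \<Rightarrow> 'w \<Rightarrow> 'v::finite \<Rightarrow> 'o::finite"
  assumes rc: "\<And>\<omega>. \<omega> \<in> space M \<Longrightarrow> right_continuous_path (\<lambda>t. X t \<omega>)"
    and meas: "\<And>t. 0 \<le> t \<Longrightarrow> X t \<in> M \<rightarrow>\<^sub>M count_space UNIV"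
  shows "consensus_event M X \<in> sets M"
proof -
  have rational: "(\<forall>t\<ge>real n. X t \<omega> = c) \<longleftrightarrow> (\<forall>q\<in>\<rat> \<inter> {real n..}. X q \<omega> = c)"
    if "\<omega> \<in> space M" for \<omega> n c
  proof (intro iffI allI impI)
    fix t assume q: "\<forall>q\<in>\<rat> \<inter> {real n..}. X q \<omega> = c" and t: "real n \<le> t"
    show "X t \<omega> = c"
      by (rule right_continuous_path_eqI[OF rc[OF that] _ _ t]) (use q in auto)
  qed auto
  have "consensus_event M X = {\<omega>\<in>space M. \<omega> \<in> consensus_event M X}"
    by (auto simp: consensus_event_def)
  also have "\<dots> =
      {\<omega>\<in>space M. \<exists>a\<in>UNIV. \<exists>n::nat. \<forall>q\<in>\<rat> \<inter> {real n..}. X q \<omega> = (\<lambda>_. a)}"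
    by (rule Collect_cong, rule conj_cong[OF refl])
       (simp only: consensus_event_iff[OF rc] rational bex_UNIV)
  also have "\<dots> \<in> sets M"
  proof (intro sets.sets_Collect_finite_Ex[OF _ finite] sets.sets_Collect_countable_Ex
      sets.sets_Collect_countable_All' countable_Int1 countable_rat)
    fix a :: 'o and n :: nat and q :: real
    assume "q \<in> \<rat> \<inter> {real n..}"
    then have "real n \<le> q" by blast
    then have "0 \<le> q" by (rule order_trans[OF of_nat_0_le_iff])
    then have "X q -` {\<lambda>_. a} \<inter> space M \<in> sets M"
      by (rule measurable_sets[OF meas]) simp
    also have "X q -` {\<lambda>_. a} \<inter> space M = {\<omega>\<in>space M. X q \<omega> = (\<lambda>_. a)}" by blast
    finally show "{\<omega>\<in>space M. X q \<omega> = (\<lambda>_. a)} \<in> sets M" .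
  qed
  finally show ?thesis .
qed


section \<open>Independence of the clock increments\<close>

lemma (in prob_space) indep_varsD_prob:
  assumes "indep_vars M' X I" "J \<subseteq> I" "J \<noteq> {}" "finite J" "\<And>i. i \<in> J \<Longrightarrow> A i \<in> sets (M' i)"
  shows "prob (\<Inter>i\<in>J. X i -` A i \<inter> space M) = (\<Prod>i\<in>J. prob (X i -` A i \<inter> space M))"
  using assms unfolding indep_vars_def2 by (intro indep_setsD[where I = I]) blast+

text \<open>Disjoint blocks are independent trials, each succeeding with probability at least
  \<open>p ^ m\<close>, so the first \<open>j\<close> all fail with probability at most
  \<open>(1 - p ^ m) ^ j\<close>, which tends to 0.\<close>

lemma (in prob_space) AE_ex_good_block:
  assumes ind: "indep_vars (\<lambda>_. count_space UNIV) X I"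
    and K: "\<And>n::nat. K n \<subseteq> I" "disjoint_family K" "\<And>n. finite (K n)" "\<And>n. card (K n) \<le> m"
    and p: "0 < p" "\<And>i. i \<in> I \<Longrightarrow> p \<le> prob (X i -` B i \<inter> space M)"
  shows "AE \<omega> in M. \<exists>n. \<forall>i\<in>K n. X i \<omega> \<in> B i"
\<comment> \<open>An empty block succeeds vacuously. Otherwise nonemptiness keeps the intersections
  over blocks inside \<open>space M\<close>.\<close>
proof (cases "\<exists>n. K n = {}")
  case False
  then have ne: "K n \<noteq> {}" for n by blast
  define Y where "Y n \<omega> = restrict (\<lambda>i. X i \<omega>) (K n)" for n \<omega>
  let ?M = "\<lambda>n. PiM (K n) (\<lambda>_. count_space UNIV)"
  have indY: "indep_vars ?M Y UNIV"
    unfolding Y_def by (rule indep_vars_restrict[OF ind K(1)]) (use K(2) in auto)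
  have X: "X i \<in> M \<rightarrow>\<^sub>M count_space UNIV" if "i \<in> I" for i
    using ind that by (auto simp: indep_vars_def)
  define G where "G n = (\<Inter>i\<in>K n. X i -` B i \<inter> space M)" for n
  have G: "G n \<in> events" for n
    unfolding G_def using X K(1) ne by (intro sets.finite_INT K(3) measurable_sets[OF X]) auto
  have "p \<le> 1"
    using p(2)[of "SOME i. i \<in> I"] ne[of 0] K(1)[of 0] prob_le_1 order_trans
    by (metis (no_types, lifting) ex_in_conv someI_ex subset_eq)
  have prob_G: "p ^ m \<le> prob (G n)" for n
  proof -
    have "p ^ m \<le> p ^ card (K n)" using p(1) \<open>p \<le> 1\<close> K(4) by (intro power_decreasing) auto
    also have "\<dots> = (\<Prod>i\<in>K n. p)" by simp
    also have "\<dots> \<le> (\<Prod>i\<in>K n. prob (X i -` B i \<inter> space M))"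
      using p K(1) by (intro prod_mono) (auto simp: less_imp_le)
    also have "\<dots> = prob (G n)"
      unfolding G_def using K ne by (intro indep_varsD_prob[OF ind, symmetric]) auto
    finally show ?thesis .
  qed
  define Bad where "Bad n = space M - G n" for n
  \<comment> \<open>Failure of a block is an event of the grouped variable \<open>Y n\<close> alone,
    which is the form that independence of the \<open>Y n\<close> applies to.\<close>
  have Bad_eq: "Bad n = Y n -` (space (?M n) - PiE (K n) B) \<inter> space M" for n
    using ne[of n] by (auto simp: Bad_def G_def Y_def space_PiM PiE_iff)
  have prob_Bad: "prob (Bad n) \<le> 1 - p ^ m" for n
    unfolding Bad_def using prob_compl[OF G, of n] prob_G[of n] by simp
  have bound: "prob (\<Inter>n. Bad n) \<le> (1 - p ^ m) ^ j" for j
  \<comment> \<open>For \<open>j = 0\<close> the bound is 1; a positive \<open>j\<close> gives the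
    nonempty index set that the product formula asks for.\<close>
  proof (cases j)
    case (Suc j')
    have "prob (\<Inter>n. Bad n) \<le> prob (\<Inter>n\<in>{..<j}. Bad n)"
      using G Suc by (intro finite_measure_mono sets.finite_INT) (auto simp: Bad_def)
    also have "\<dots> = (\<Prod>n<j. prob (Bad n))"
      unfolding Bad_eq using K(3) Suc
      by (intro indep_varsD_prob[OF indY]) (auto intro!: sets.Diff sets_PiM_I_finite)
    also have "\<dots> \<le> (\<Prod>n<j. 1 - p ^ m)" by (intro prod_mono) (simp add: prob_Bad)
    finally show ?thesis by simp
  qed simp
  have "prob (\<Inter>n. Bad n) \<le> 0"
  proof (rule LIMSEQ_le_const)
    have "p ^ m \<le> 1" using p(1) \<open>p \<le> 1\<close> by (intro power_le_one) auto
    then show "(\<lambda>j. (1 - p ^ m) ^ j) \<longlonglongrightarrow> 0"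
      using p(1) by (intro LIMSEQ_realpow_zero) auto
  qed (use bound in blast)
  then have "prob (\<Inter>n. Bad n) = 0" using measure_nonneg by (intro antisym)
  then have "(\<Inter>n. Bad n) \<in> null_sets M"
    using G by (intro null_setsI) (auto simp: emeasure_eq_measure Bad_def)
  then show ?thesis
    by (rule AE_I') (auto simp: Bad_def G_def)
qed auto

definition clock_increment :: "('e \<Rightarrow> real \<Rightarrow> 'w \<Rightarrow> nat) \<Rightarrow> 'e \<times> nat \<Rightarrow> 'w \<Rightarrow> nat" where
  "clock_increment N = (\<lambda>(e, k) \<omega>. N e (real (Suc k)) \<omega> - N e (real k) \<omega>)"

text \<open>Places the increments of a clock in the sigma-algebra of that clock, the level at which
  different clocks are assumed independent.\<close>

lemma clock_increment_generated:
  "clock_increment N (e, k) -` A \<inter> space M \<in> generated_events M (N e ` {0..})"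
proof -
  define Q where "Q = {f -` A \<inter> space M | f A. f \<in> N e ` {0..}}"
  have Q: "Q \<subseteq> Pow (space M)" by (auto simp: Q_def)
  have "N e t \<in> sigma (space M) Q \<rightarrow>\<^sub>M count_space UNIV" if "0 \<le> t" for t
  proof (rule measurableI)
    fix A :: "nat set"
    have "N e t -` A \<inter> space M \<in> Q" using that by (auto simp: Q_def)
    then show "N e t -` A \<inter> space (sigma (space M) Q) \<in> sets (sigma (space M) Q)"
      using Q by (simp add: sigma_sets.Basic)
  qed simp
  then have [measurable]: "N e (real k) \<in> sigma (space M) Q \<rightarrow>\<^sub>M count_space UNIV" for k
    by simp
  have "clock_increment N (e, k) \<in> sigma (space M) Q \<rightarrow>\<^sub>M count_space UNIV"
    unfolding clock_increment_def prod.case by measurable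
  then have "clock_increment N (e, k) -` A \<inter> space (sigma (space M) Q) \<in> sets (sigma (space M) Q)"
    by (rule measurable_sets) simp
  then show ?thesis using Q by (simp add: generated_events_def Q_def)
qed

text \<open>Two kinds of independence are combined. A finite index set is split into rows, one per
  edge; the product formula holds across rows by independence of the clocks and within a row by the
  Poisson property.\<close>

lemma (in prob_space) indep_clock_increments:
  assumes poisson: "\<And>e. e \<in> D \<Longrightarrow> poisson_process M r (N e)"
    and ind: "indep_sets (\<lambda>e. generated_events M (N e ` {0..})) D"
  shows "indep_vars (\<lambda>_. count_space UNIV) (clock_increment N) (D \<times> UNIV)"
  unfolding indep_vars_def2
proof (intro conjI ballI indep_setsI)
  fix i assume "i \<in> D \<times> (UNIV :: nat set)"
  then obtain e k where i: "i = (e, k)" "e \<in> D" by auto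
  have [measurable]: "N e (real k) \<in> M \<rightarrow>\<^sub>M count_space UNIV" for k
    using poisson[OF i(2)] by (simp add: poisson_process_def)
  show X: "clock_increment N i \<in> M \<rightarrow>\<^sub>M count_space UNIV"
    unfolding clock_increment_def i prod.case by measurable
  show "{clock_increment N i -` A \<inter> space M |A. A \<in> sets (count_space UNIV)} \<subseteq> events"
    using measurable_sets[OF X] by auto
next
  fix A J
  assume J: "J \<noteq> {}" "J \<subseteq> D \<times> (UNIV :: nat set)" "finite J"
    and A: "\<forall>j\<in>J. A j \<in> {clock_increment N j -` B \<inter> space M |B. B \<in> sets (count_space UNIV)}"
  define L where "L e = {k. (e, k) \<in> J}" for e
  have J_eq: "J = (SIGMA e:fst ` J. L e)" by (force simp: L_def)
  have finL: "finite (L e)" for e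
    using finite_imageI[OF J(3), of snd] by (rule rev_finite_subset) (force simp: L_def)
  have L: "e \<in> D" "L e \<noteq> {}" if "e \<in> fst ` J" for e using that J(2) by (auto simp: L_def)
  have gen: "(\<Inter>k\<in>L e. A (e, k)) \<in> generated_events M (N e ` {0..})" if "e \<in> fst ` J" for e
  proof -
    interpret G: sigma_algebra "space M" "generated_events M (N e ` {0..})"
      unfolding generated_events_def by (intro sigma_algebra_sigma_sets) auto
    have "A (e, k) \<in> generated_events M (N e ` {0..})" if "k \<in> L e" for k
      using A that clock_increment_generated[of N e k _ M] by (force simp: L_def)
    then show ?thesis using finL L(2)[OF that] by (intro G.finite_INT) auto
  qed
  have row: "prob (\<Inter>k\<in>L e. A (e, k)) = (\<Prod>k\<in>L e. prob (A (e, k)))" if e: "e \<in> fst ` J" for e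
  proof -
    \<comment> \<open>The Poisson property is instantiated with the integers as partition
      times.\<close>
    have "0 \<le> real 0 \<and> strict_mono real \<longrightarrow>
        indep_vars (\<lambda>_. count_space UNIV) (\<lambda>i \<omega>. N e (real (Suc i)) \<omega> - N e (real i) \<omega>) UNIV"
      using poisson[OF L(1)[OF e]] unfolding poisson_process_def by blast
    moreover have "strict_mono real" by (simp add: strict_mono_def)
    ultimately have "indep_vars (\<lambda>_. count_space UNIV) (\<lambda>k. clock_increment N (e, k)) UNIV"
      by (simp add: clock_increment_def)
    then show ?thesis
      unfolding indep_vars_def2 using finL L(2)[OF e] A
      by (intro indep_setsD[where I = UNIV]) (auto simp: L_def)
  qed
  have "(\<Inter>j\<in>J. A j) = (\<Inter>e\<in>fst ` J. \<Inter>k\<in>L e. A (e, k))" by (subst J_eq) auto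
  then have "prob (\<Inter>j\<in>J. A j) = prob (\<Inter>e\<in>fst ` J. \<Inter>k\<in>L e. A (e, k))" by simp
  also have "\<dots> = (\<Prod>e\<in>fst ` J. prob (\<Inter>k\<in>L e. A (e, k)))"
    using J gen L by (intro indep_setsD[OF ind]) auto
  also have "\<dots> = (\<Prod>e\<in>fst ` J. \<Prod>k\<in>L e. prob (A (e, k)))" by (simp add: row)
  also have "\<dots> = (\<Prod>(e, k)\<in>(SIGMA e:fst ` J. L e). prob (A (e, k)))"
    using J(3) finL by (intro prod.Sigma) auto
  also have "\<dots> = (\<Prod>j\<in>J. prob (A j))" by (subst J_eq[symmetric]) (simp add: case_prod_beta)
  finally show "prob (\<Inter>j\<in>J. A j) = (\<Prod>j\<in>J. prob (A j))" .
qed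

text \<open>A Poisson variable of mean 1 takes the values 0 and 1 with the same probability
  \<open>exp (-1)\<close>, so one bound serves both for ringing and for staying silent.\<close>

lemma prob_clock_increment_ge:
  assumes "poisson_process M 1 (N e)" "n \<in> B" "n \<le> 1"
  shows "exp (-1) \<le> measure M (clock_increment N (e, k) -` B \<inter> space M)"
proof -
  have [measurable]: "N e (real k) \<in> M \<rightarrow>\<^sub>M count_space UNIV" for k
    using assms(1) by (simp add: poisson_process_def)
  have X: "clock_increment N (e, k) \<in> M \<rightarrow>\<^sub>M count_space UNIV"
    unfolding clock_increment_def prod.case by measurable
  have "distr M (count_space UNIV) (clock_increment N (e, k)) =
      measure_pmf (poisson_pmf (1 * (real (Suc k) - real k)))"
    using assms(1) unfolding poisson_process_def clock_increment_def prod.case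
    by (metis lessI of_nat_0_le_iff of_nat_less_iff)
  then have distr: "distr M (count_space UNIV) (clock_increment N (e, k)) =
      measure_pmf (poisson_pmf 1)" by simp
  have "exp (-1) = pmf (poisson_pmf 1) n"
    using assms(3) by (cases n) auto
  also have "\<dots> = measure (measure_pmf (poisson_pmf 1)) {n}" by (simp add: measure_pmf_single)
  also have "\<dots> \<le> measure (measure_pmf (poisson_pmf 1)) B"
    using assms(2) by (intro measure_pmf.finite_measure_mono) auto
  also have "\<dots> = measure M (clock_increment N (e, k) -` B \<inter> space M)"
    unfolding distr[symmetric] using X by (intro measure_distr) auto
  finally show ?thesis .
qed


section \<open>Almost sure consensus\<close>

text \<open>Covers both processes: the update rule enters only through \<open>follows_clocks\<close>
  with \<open>moves_towards\<close>.\<close>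

lemma prob_consensus_eq_1:
  fixes S :: "'v::finite set set" and E :: "'o::finite set set"
    and X :: "real \<Rightarrow> 'w \<Rightarrow> 'v \<Rightarrow> 'o"
  assumes graphs: "simple_graph S" "graph_connected S" "graph_connected E"
    and "prob_space M"
    and poisson: "\<And>e. e \<in> directed_edges S \<Longrightarrow> poisson_process M 1 (N e)"
    and ind: "prob_space.indep_sets M (\<lambda>e. generated_events M (N e ` {0..})) (directed_edges S)"
    and meas: "\<And>t. 0 \<le> t \<Longrightarrow> X t \<in> M \<rightarrow>\<^sub>M count_space UNIV"
    and rc: "\<And>\<omega>. \<omega> \<in> space M \<Longrightarrow> right_continuous_path (\<lambda>t. X t \<omega>)"
    and fol: "AE \<omega> in M. follows_clocks (directed_edges S) N (moves_towards E) X \<omega>"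
  shows "measure M (consensus_event M X) = 1"
proof -
  interpret prob_space M by fact
  let ?D = "directed_edges S"
  obtain es where es: "set es \<subseteq> ?D"
    "\<And>c c'. steps (moves_towards E) es c c' \<Longrightarrow> \<exists>a. c' = (\<lambda>_. a)"
    using ex_universal_edge_list[OF graphs(2,3)] by blast
  define L where "L = length es"
  define K where "K n = ?D \<times> {n * L..<n * L + L}" for n
  \<comment> \<open>Block \<open>n\<close> starts at time \<open>n * L\<close>, so
    \<open>k mod L\<close> is the position in the list: the listed edge must ring and the others
    stay silent. If \<open>L = 0\<close>, all blocks are empty, which
    \<open>AE_ex_good_block\<close> allows.\<close>
  define B :: "('v \<times> 'v) \<times> nat \<Rightarrow> nat set"
    where "B = (\<lambda>(e, k). if e = es ! (k mod L) then {1..} else {0})"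
  have "disjoint_family K"
    unfolding disjoint_family_on_def
  proof (intro ballI impI)
    fix m n :: nat assume "m \<noteq> n"
    \<comment> \<open>Division by \<open>L\<close> recovers the number of the block, whence
      disjointness.\<close>
    have block: "k div L = i" if "k \<in> {i * L..<i * L + L}" for k i :: nat
      using that by (intro div_nat_eqI) (auto simp: algebra_simps)
    have False if "i \<in> K m" "i \<in> K n" for i
      using that block[of "snd i" m] block[of "snd i" n] \<open>m \<noteq> n\<close> by (auto simp: K_def)
    then show "K m \<inter> K n = {}" by blast
  qed
  have good: "AE \<omega> in M. \<exists>n. \<forall>i\<in>K n. clock_increment N i \<omega> \<in> B i"
  proof (rule AE_ex_good_block[OF indep_clock_increments[OF poisson ind] _ \<open>disjoint_family K\<close>])
    fix i assume "i \<in> ?D \<times> (UNIV :: nat set)"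
    then obtain e k where i: "i = (e, k)" "e \<in> ?D" by auto
    have "(if e = es ! (k mod L) then 1 else 0) \<in> B i" by (simp add: B_def i)
    then show "exp (-1) \<le> prob (clock_increment N i -` B i \<inter> space M)"
      unfolding i by (rule prob_clock_increment_ge[where N = N, OF poisson[OF i(2)]]) simp
  next
    show "card (K n) \<le> card ?D * L" for n by (simp add: K_def card_cartesian_product)
  qed (auto simp: K_def)
  from AE_space fol good have "AE \<omega> in M. \<omega> \<in> consensus_event M X"
  proof eventually_elim
    fix \<omega>
    assume space: "\<omega> \<in> space M"
      and fol: "follows_clocks ?D N (moves_towards E) X \<omega>"
      and "\<exists>n. \<forall>i\<in>K n. clock_increment N i \<omega> \<in> B i"
    then obtain n where n: "\<And>e k. (e, k) \<in> K n \<Longrightarrow> clock_increment N (e, k) \<omega> \<in> B (e, k)" by blast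
    have paths: "mono_on {0..} (\<lambda>t. N e t \<omega>)" "right_continuous_path (\<lambda>t. N e t \<omega>)" if "e \<in> ?D" for e
      using poisson[OF that] space by (auto simp: poisson_process_def)
    have incr: "N e (real (Suc (n * L + i))) \<omega> - N e (real (n * L + i)) \<omega> \<in>
        (if e = es ! i then {1..} else {0})" if "e \<in> ?D" "i < L" for e i
      using n[of e "n * L + i"] that by (simp add: K_def B_def clock_increment_def)
    have "steps (moves_towards E) es (X (real (n * L)) \<omega>) (X (real (n * L + length es)) \<omega>)"
    proof (rule steps_along_block[OF rc[OF space] paths(2,1) fol _ es(1)])
      show "fst e \<noteq> snd e" if "e \<in> ?D" for e
        using that directed_edges_irrefl[OF graphs(1)] by (metis prod.collapse)
    next
      fix i assume i: "i < length es"
      then have "es ! i \<in> ?D" using es(1) by auto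
      from incr[OF this, of i] i
      show "N (es ! i) (real (n * L + i)) \<omega> < N (es ! i) (real (Suc (n * L + i))) \<omega>"
        by (simp add: L_def)
    next
      fix i e assume i: "i < length es" "e \<in> ?D" "e \<noteq> es ! i"
      \<comment> \<open>A truncated difference of 0 gives only this inequality; monotonicity of the
        clock supplies the reverse one.\<close>
      then have "N e (real (Suc (n * L + i))) \<omega> \<le> N e (real (n * L + i)) \<omega>"
        using incr[OF i(2), of i] by (simp add: L_def)
      moreover have "N e (real (n * L + i)) \<omega> \<le> N e (real (Suc (n * L + i))) \<omega>"
        by (rule mono_onD[OF paths(1)[OF i(2)]]) auto
      ultimately show "N e (real (Suc (n * L + i))) \<omega> = N e (real (n * L + i)) \<omega>" by simp
    qed
    then obtain a where a: "X (real (n * L + length es)) \<omega> = (\<lambda>_. a)" using es(2) by blast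
    have "X t \<omega> = (\<lambda>_. a)" if "real (n * L + length es) \<le> t" for t
      using consensus_persists[OF rc[OF space] graphs(3) fol _ that a] by simp
    then show "\<omega> \<in> consensus_event M X"
      unfolding consensus_event_iff[where X = X, OF rc[OF space] space] by blast
  qed
  moreover have "consensus_event M X \<in> events" by (rule sets_consensus_event[OF rc meas])
  ultimately show ?thesis by (simp add: prob_eq_1)
qed

text \<open>Independence passes to subfamilies, and \<open>Clock\<close> is injective, so the clocks
  can be reindexed by edges. The form with \<open>case_source\<close> fits both processes.\<close>

lemma (in prob_space) indep_sets_clocks:
  assumes "indep_sets (case_source G F H) I" "Clock ` D \<subseteq> I"
  shows "indep_sets F D"
proof (rule indep_setsI)
  have sub: "indep_sets (case_source G F H) (Clock ` D)"
    using indep_sets_mono_index[OF assms(2,1)] .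
  show "F e \<subseteq> events" if "e \<in> D" for e
    using sub that unfolding indep_sets_def by force
  fix A J assume J: "J \<noteq> {}" "J \<subseteq> D" "finite J" "\<forall>j\<in>J. A j \<in> F j"
  let ?A = "\<lambda>i. case i of Clock e \<Rightarrow> A e | _ \<Rightarrow> {}"
  have "prob (\<Inter>i\<in>Clock ` J. ?A i) = (\<Prod>i\<in>Clock ` J. prob (?A i))"
    using J by (intro indep_setsD[OF sub]) auto
  then show "prob (\<Inter>j\<in>J. A j) = (\<Prod>j\<in>J. prob (A j))"
    by (simp add: prod.reindex inj_on_def)
qed

text \<open>The index of the choice used at a ring is the random count of the clock, so a single
  null set has to serve all \<open>k\<close>; edges and opinions are finite and \<open>k\<close> is
  countable.\<close>

lemma AE_choices_closer:
  assumes "simple_graph E" "graph_connected E" "attraction_process S E \<tau> M N C \<zeta>"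
  shows "AE \<omega> in M. \<forall>e\<in>directed_edges S. \<forall>k a b. a \<noteq> b \<longrightarrow>
    C e k \<omega> a b \<in> closer_neighbours E a b"
proof -
  have "AE \<omega> in M. a \<noteq> b \<longrightarrow> C e k \<omega> a b \<in> closer_neighbours E a b"
    if e: "e \<in> directed_edges S" for e k a b
  proof (cases "a = b")
    case False
    have C: "C e k \<in> M \<rightarrow>\<^sub>M count_space UNIV"
      and distr: "distr M (count_space UNIV) (\<lambda>\<omega>. C e k \<omega> a b) =
          measure_pmf (pmf_of_set (closer_neighbours E a b))"
      using assms(3) e False by (auto simp: attraction_process_def)
    have Cab: "(\<lambda>\<omega>. C e k \<omega> a b) \<in> M \<rightarrow>\<^sub>M count_space UNIV"
      using measurable_compose[OF C, of "\<lambda>g. g a b"] by simp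
    have "AE z in measure_pmf (pmf_of_set (closer_neighbours E a b)). z \<in> closer_neighbours E a b"
      using AE_measure_pmf[of "pmf_of_set (closer_neighbours E a b)"]
        closer_neighbours_nonempty[OF assms(1,2) False] by (simp add: set_pmf_of_set)
    then have "AE \<omega> in M. C e k \<omega> a b \<in> closer_neighbours E a b"
      unfolding distr[symmetric] by (subst (asm) AE_distr_iff[OF Cab]) auto
    then show ?thesis by eventually_elim simp
  qed simp
  then have "AE \<omega> in M. \<forall>e\<in>directed_edges S. \<forall>a\<in>UNIV. \<forall>b\<in>UNIV. \<forall>k. a \<noteq> b \<longrightarrow>
      C e k \<omega> a b \<in> closer_neighbours E a b"
    by (intro AE_finite_allI[OF finite] AE_all_countable[THEN iffD2] allI)
  then show ?thesis by eventually_elim blast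
qed

theorem theorem1:
  fixes S :: "'v::finite set set" and E :: "'o::finite set set" and \<tau> :: nat
    and M :: "'w measure" and M' :: "'w2 measure"
    and N :: "'v \<times> 'v \<Rightarrow> real \<Rightarrow> 'w \<Rightarrow> nat" and N' :: "'v \<times> 'v \<Rightarrow> real \<Rightarrow> 'w2 \<Rightarrow> nat"
    and C :: "'v \<times> 'v \<Rightarrow> nat \<Rightarrow> 'w2 \<Rightarrow> 'o \<Rightarrow> 'o \<Rightarrow> 'o"
    and \<xi> :: "real \<Rightarrow> 'w \<Rightarrow> 'v \<Rightarrow> 'o" and \<zeta> :: "real \<Rightarrow> 'w2 \<Rightarrow> 'v \<Rightarrow> 'o"
  assumes "simple_graph S" and "graph_connected S"
    and "simple_graph E" and "graph_connected E"
    and "imitation_process S E \<tau> M N \<xi>"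
    and "attraction_process S E \<tau> M' N' C \<zeta>"
    and "\<tau> \<ge> graph_diameter E"
  shows "measure M (consensus_event M \<xi>) = 1 \<and> measure M' (consensus_event M' \<zeta>) = 1"
proof
  note imi = assms(5)[unfolded imitation_process_def]
  then interpret M: prob_space M by blast
  show "measure M (consensus_event M \<xi>) = 1"
  proof (rule prob_consensus_eq_1[OF assms(1,2,4)])
    show "M.indep_sets (\<lambda>e. generated_events M (N e ` {0..})) (directed_edges S)"
      using imi by (elim conjE) (rule M.indep_sets_clocks, assumption, blast)
    have "AE \<omega> in M. evolves_by (directed_edges S) N (\<lambda>e \<omega> t. imitation_update E \<tau> e) \<xi> \<omega>"
      using imi by blast
    then show "AE \<omega> in M. follows_clocks (directed_edges S) N (moves_towards E) \<xi> \<omega>"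
      by eventually_elim
        (erule evolves_by_imp_follows_clocks, rule moves_towards_imitation[OF assms(4,7)])
  qed (use imi in auto)
next
  note att = assms(6)[unfolded attraction_process_def]
  then interpret M': prob_space M' by blast
  show "measure M' (consensus_event M' \<zeta>) = 1"
  proof (rule prob_consensus_eq_1[OF assms(1,2,4)])
    show "M'.indep_sets (\<lambda>e. generated_events M' (N' e ` {0..})) (directed_edges S)"
      using att by (elim conjE) (rule M'.indep_sets_clocks, assumption, blast)
    have "AE \<omega> in M'. evolves_by (directed_edges S) N'
        (\<lambda>e \<omega> t. attraction_update E \<tau> (C e (N' e t \<omega>) \<omega>) e) \<zeta> \<omega>"
      using att by blast
    \<comment> \<open>Off the null set for the choices, \<open>moves_towards_attraction\<close>
      applies at each ring to the choice function in force there.\<close>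
    with AE_choices_closer[OF assms(3,4,6)]
    show "AE \<omega> in M'. follows_clocks (directed_edges S) N' (moves_towards E) \<zeta> \<omega>"
      by eventually_elim
        (erule evolves_by_imp_follows_clocks, rule moves_towards_attraction[OF assms(4,7)], blast)
  qed (use att in auto)
qed

end
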